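(* Let $(G_n)_{n\ge 0}$ be the sequence of graphs with special vertices $X_n,Y_n$ defined in the context, let $T_n(x,y)=T(G_n;x,y)$ be the Tutte polynomial of $G_n$, and let $T_{1,n}(x,y)$ and $N_n(x,y)$ be the polynomials in $\mathbb{Z}[x,y]$ defined in the context. Then for every $n\ge 0$ the Tutte polynomial of $G_{n+1}$ is given by $$T_{n+1}(x,y)=T_{1,n+1}(x,y)+(x-1)N_{n+1}(x,y),$$ where the polynomials $T_{1,n+1}$ and $N_{n+1}$ satisfy the following recursive relations (with $T_{1,n}=T_{1,n}(x,y)$, $N_n=N_n(x,y)$): $$T_{1,n+1}(x,y)=y(y-1)\,T_{1,n}^{4}+4y\,T_{1,n}^{3}N_{n}+(2x+2)\,T_{1,n}^{2}N_{n}^{2},$$ $$N_{n+1}(x,y)=(2y+2)\,T_{1,n}^{2}N_{n}^{2}+4x\,T_{1,n}N_{n}^{3}+x(x-1)\,N_{n}^{4},$$ with initial conditions $T_{1,0}(x,y)=1$ and $N_{0}(x,y)=1$.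
   Context: Tutte polynomial: for a graph $G$ with vertex set $V(G)$, edge set $E(G)$ and $k(G)$ connected components, put $r(G)=|V(G)|-k(G)$ and $n(G)=|E(G)|-|V(G)|+k(G)$. Then $T(G;x,y)=\sum_{H\subseteq G}(x-1)^{r(G)-r(H)}(y-1)^{n(H)}$, where the sum runs over all spanning subgraphs $H$ of $G$ (subgraphs with $V(H)=V(G)$ and arbitrary $E(H)\subseteq E(G)$). The graphs $G_n$: $G_0$ is the complete graph $K_2$ with its two vertices denoted $X_0,Y_0$. For $n\ge 0$, given $G_n$ with two special vertices $X_n,Y_n$, take four disjoint copies $G_n^1,G_n^2,G_n^3,G_n^4$ of $G_n$, with special vertices $X_n^i,Y_n^i$. Identify $X_n^1$ with $X_n^2$ to form the special vertex $X_{n+1}$ of $G_{n+1}$; identify $Y_n^3$ with $Y_n^4$ to form the special vertex $Y_{n+1}$ of $G_{n+1}$; identify $Y_n^1$ with $X_n^3$ to form a vertex $a$, and $Y_n^2$ with $X_n^4$ to form a vertex $b$; finally add a new edge $e_n$ joining $a$ and $b$. The result is $G_{n+1}$. Partial sums: let $\mathcal{G}_{1,n}$ be the set of spanning subgraphs $H$ of $G_n$ in which $X_n$ and $Y_n$ belong to the same connected component of $H$, and $\mathcal{G}_{2,n}$ the set of spanning subgraphs in which $X_n$ and $Y_n$ do not belong to the same component. For $i=1,2$, $T_{i,n}(x,y)=\sum_{H\in\mathcal{G}_{i,n}}(x-1)^{r(G_n)-r(H)}(y-1)^{n(H)}$. The polynomial $x-1$ divides $T_{2,n}(x,y)$ in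 $\mathbb{Z}[x,y]$, and $N_n(x,y)\in\mathbb{Z}[x,y]$ denotes the quotient, i.e. $T_{2,n}(x,y)=(x-1)N_n(x,y)$. *)

theory Defs
  imports "HOL-Computational_Algebra.Polynomial"
begin

section \<open>Multigraphs and the Tutte polynomial\<close>

text \<open>
  \<open>ends G e\<close> is the set of endpoints of the edge \<open>e\<close>, a singleton for a loop; its
  values outside \<open>edges G\<close> are irrelevant.
\<close>

record ('v, 'e) mgraph =
  verts :: "'v set"
  edges :: "'e set"
  ends :: "'e \<Rightarrow> 'v set"

definition adj :: "('v, 'e) mgraph \<Rightarrow> ('v \<times> 'v) set" where
  "adj G = {(u, v). \<exists>e\<in>edges G. ends G e = {u, v}}"

definition conn_rel :: "('v, 'e) mgraph \<Rightarrow> ('v \<times> 'v) set" where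
  "conn_rel G = {(u, v). u \<in> verts G \<and> v \<in> verts G \<and> (u, v) \<in> (adj G)\<^sup>*}"

definition conn_components :: "('v, 'e) mgraph \<Rightarrow> 'v set set" where
  "conn_components G = verts G // conn_rel G"

definition same_component :: "('v, 'e) mgraph \<Rightarrow> 'v \<Rightarrow> 'v \<Rightarrow> bool" where
  "same_component G u v \<longleftrightarrow> (\<exists>C\<in>conn_components G. u \<in> C \<and> v \<in> C)"

text \<open>
  For a finite graph, every connected component is nonempty and the number of
  edges plus the number of components is at least the number of vertices, so
  the subtractions on \<open>nat\<close> in the next two definitions do not truncate.
  Neither does the one in \<open>tutte_term G H\<close> if \<open>H\<close> is a spanning subgraph of \<open>G\<close>.
\<close>

definition rank :: "('v, 'e) mgraph \<Rightarrow> nat" where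
  "rank G = card (verts G) - card (conn_components G)"

definition nullity :: "('v, 'e) mgraph \<Rightarrow> nat" where
  "nullity G = card (edges G) + card (conn_components G) - card (verts G)"

definition spanning_subgraphs :: "('v, 'e) mgraph \<Rightarrow> ('v, 'e) mgraph set" where
  "spanning_subgraphs G =
     {H. verts H = verts G \<and> edges H \<subseteq> edges G \<and> ends H = ends G}"

text \<open>
  The ring of integer polynomials in two variables is rendered as
  \<^typ>\<open>int poly poly\<close>, with \<open>varx\<close> the outer and \<open>vary\<close> the inner variable.
\<close>

definition varx :: "int poly poly" where
  "varx = [:0, 1:]"

definition vary :: "int poly poly" where
  "vary = [:[:0, 1:]:]"

definition tutte_term :: "('v, 'e) mgraph \<Rightarrow> ('v, 'e) mgraph \<Rightarrow> int poly poly" where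
  "tutte_term G H = (varx - 1) ^ (rank G - rank H) * (vary - 1) ^ nullity H"

definition tutte :: "('v, 'e) mgraph \<Rightarrow> int poly poly" where
  "tutte G = (\<Sum>H\<in>spanning_subgraphs G. tutte_term G H)"


section \<open>The sequence of graphs\<close>

datatype copy = C1 | C2 | C3 | C4

text \<open>
  The special vertices are called \<open>VX\<close> and \<open>VY\<close> in every graph of the sequence,
  and \<open>VA\<close>, \<open>VB\<close> are the other two vertices produced by the identifications.
  \<open>Inner i v\<close> is the vertex \<open>v\<close> of the \<open>i\<close>-th copy, where \<open>v\<close> is not special.
\<close>

datatype vertex = VX | VY | VA | VB | Inner copy vertex

datatype edge = Initial | Copied copy edge | Added

text \<open>
  \<open>glue i v\<close> is the vertex that the copy of \<open>v\<close> in the \<open>i\<close>-th copy becomes after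
  the identifications; two vertices are identified iff they have the same image.
\<close>

fun glue :: "copy \<Rightarrow> vertex \<Rightarrow> vertex" where
  "glue C1 VX = VX"
| "glue C2 VX = VX"
| "glue C3 VY = VY"
| "glue C4 VY = VY"
| "glue C1 VY = VA"
| "glue C3 VX = VA"
| "glue C2 VY = VB"
| "glue C4 VX = VB"
| "glue i v = Inner i v"

definition K2 :: "(vertex, edge) mgraph" where
  "K2 = \<lparr>verts = {VX, VY}, edges = {Initial}, ends = (\<lambda>e. {VX, VY})\<rparr>"

definition step :: "(vertex, edge) mgraph \<Rightarrow> (vertex, edge) mgraph" where
  "step G =
     \<lparr>verts = (\<Union>i. glue i ` verts G),
      edges = insert Added (\<Union>i. Copied i ` edges G),
      ends = (\<lambda>e. case e of
          Initial \<Rightarrow> {}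
        | Copied i e' \<Rightarrow> glue i ` ends G e'
        | Added \<Rightarrow> {VA, VB})\<rparr>"

primrec Gr :: "nat \<Rightarrow> (vertex, edge) mgraph" where
  "Gr 0 = K2"
| "Gr (Suc n) = step (Gr n)"


section \<open>The partial sums\<close>

definition T1 :: "nat \<Rightarrow> int poly poly" where
  "T1 n = (\<Sum>H\<in>{H \<in> spanning_subgraphs (Gr n). same_component H VX VY}.
             tutte_term (Gr n) H)"

definition T2 :: "nat \<Rightarrow> int poly poly" where
  "T2 n = (\<Sum>H\<in>{H \<in> spanning_subgraphs (Gr n). \<not> same_component H VX VY}.
             tutte_term (Gr n) H)"

text \<open>
  The division is exact, because every graph of the sequence is connected.
\<close>

definition N :: "nat \<Rightarrow> int poly poly" where
  "N n = T2 n div (varx - 1)"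

end

theory Submission
  imports Defs "HOL-Library.FuncSet"
begin

text \<open>
  A spanning subgraph of \<open>step G\<close> consists of spanning subgraphs \<open>H\<^sub>i\<close> of the four copies and
  possibly the added edge. Its components either lie inside one copy and avoid the special
  vertices of that copy, or correspond to the components of a skeleton on \<open>VX\<close>, \<open>VY\<close>, \<open>VA\<close>,
  \<open>VB\<close>, in which copy \<open>i\<close> is replaced by an edge if \<open>H\<^sub>i\<close> connects its special vertices and
  is deleted otherwise. Hence the nullity and the number of components without special vertices
  are both additive over the skeleton and the \<open>H\<^sub>i\<close>. The contribution of a subgraph,
  freed of one factor \<open>x - 1\<close> if its special vertices are not connected, is therefore
  multiplicative, and the recursion is a sum over the 32 skeletons.
\<close>

section \<open>Counting components with labellings\<close>

definition wf_mgraph :: "('v, 'e) mgraph \<Rightarrow> bool" where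
  "wf_mgraph G \<longleftrightarrow> finite (verts G) \<and> finite (edges G) \<and>
     (\<forall>e\<in>edges G. \<exists>u\<in>verts G. \<exists>v\<in>verts G. ends G e = {u, v})"

text \<open>A labelling whose fibres on the vertices are the components. Components can then be
  counted as labels, and the labels can be chosen to suit the graph at hand, without handling
  equivalence classes.\<close>

definition labels_components :: "('v, 'e) mgraph \<Rightarrow> ('v \<Rightarrow> 'l) \<Rightarrow> bool" where
  "labels_components G f \<longleftrightarrow>
     (\<forall>u\<in>verts G. \<forall>v\<in>verts G. f u = f v \<longleftrightarrow> (u, v) \<in> (adj G)\<^sup>*)"

definition comp_of :: "('v, 'e) mgraph \<Rightarrow> 'v \<Rightarrow> 'v set" where
  "comp_of G v = conn_rel G `` {v}"

lemma conn_components_eq: "conn_components G = comp_of G ` verts G"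
  by (auto simp: conn_components_def comp_of_def quotient_def)

lemma adj_rtrancl_sym: "(u, v) \<in> (adj G)\<^sup>* \<Longrightarrow> (v, u) \<in> (adj G)\<^sup>*"
proof -
  have "sym (adj G)"
    by (auto simp: sym_def adj_def insert_commute)
  then show "(u, v) \<in> (adj G)\<^sup>* \<Longrightarrow> (v, u) \<in> (adj G)\<^sup>*"
    by (meson symD sym_rtrancl)
qed

lemma adjI: "e \<in> edges G \<Longrightarrow> ends G e = {u, v} \<Longrightarrow> (u, v) \<in> (adj G)\<^sup>*"
  by (auto simp: adj_def)

lemma labels_components_comp_of: "labels_components G (comp_of G)"
  unfolding labels_components_def
proof (intro ballI iffI)
  fix u v
  assume uv: "u \<in> verts G" "v \<in> verts G"
  show "(u, v) \<in> (adj G)\<^sup>*" if "comp_of G u = comp_of G v"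
  proof -
    have "v \<in> comp_of G v"
      using uv by (simp add: comp_of_def conn_rel_def)
    with that show ?thesis
      by (auto simp: comp_of_def conn_rel_def)
  qed
  show "comp_of G u = comp_of G v" if "(u, v) \<in> (adj G)\<^sup>*"
    using that uv adj_rtrancl_sym[OF that]
    by (auto simp: comp_of_def conn_rel_def intro: rtrancl_trans)
qed

text \<open>Constancy along edges propagates along paths, so this direction has to be checked on
  single edges only.\<close>

lemma labels_componentsI:
  assumes "\<And>e u v. e \<in> edges G \<Longrightarrow> ends G e = {u, v} \<Longrightarrow> f u = f v"
    and "\<And>u v. u \<in> verts G \<Longrightarrow> v \<in> verts G \<Longrightarrow> f u = f v \<Longrightarrow> (u, v) \<in> (adj G)\<^sup>*"
  shows "labels_components G f"
proof -
  have "f u = f v" if "(u, v) \<in> (adj G)\<^sup>*" for u v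
    using that by induction (auto simp: adj_def dest: assms(1))
  with assms(2) show ?thesis
    unfolding labels_components_def by blast
qed

text \<open>The components are the nonempty fibres of \<open>f\<close>, one for each label
  attained.\<close>

lemma card_conn_components:
  assumes "labels_components G f"
  shows "card (conn_components G) = card (f ` verts G)"
proof -
  let ?fib = "\<lambda>l. {v \<in> verts G. f v = l}"
  have "comp_of G u = ?fib (f u)" if "u \<in> verts G" for u
    using assms that by (auto intro: adj_rtrancl_sym simp: labels_components_def comp_of_def conn_rel_def)
  then have "conn_components G = ?fib ` f ` verts G"
    by (simp add: conn_components_eq image_image)
  moreover have "inj_on ?fib (f ` verts G)"
    by (auto simp: inj_on_def)
  ultimately show ?thesis
    by (simp add: card_image)
qed

lemma same_component_iff:
  assumes "u \<in> verts G" "v \<in> verts G"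
  shows "same_component G u v \<longleftrightarrow> (u, v) \<in> (adj G)\<^sup>*"
proof
  assume "same_component G u v"
  then obtain w where "(w, u) \<in> (adj G)\<^sup>*" "(w, v) \<in> (adj G)\<^sup>*"
    by (auto simp: same_component_def conn_components_eq comp_of_def conn_rel_def)
  then show "(u, v) \<in> (adj G)\<^sup>*"
    by (meson adj_rtrancl_sym rtrancl_trans)
next
  assume "(u, v) \<in> (adj G)\<^sup>*"
  with assms have "u \<in> comp_of G u" "v \<in> comp_of G u" "comp_of G u \<in> conn_components G"
    by (auto simp: conn_components_eq comp_of_def conn_rel_def)
  then show "same_component G u v"
    by (auto simp: same_component_def)
qed

lemma same_component_label:
  assumes "labels_components G f" "u \<in> verts G" "v \<in> verts G"
  shows "same_component G u v \<longleftrightarrow> f u = f v"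
  using assms by (simp add: same_component_iff labels_components_def)

section \<open>Insertion of an edge, counting bounds and edge sets\<close>

definition merge :: "'v \<Rightarrow> 'v \<Rightarrow> ('v \<Rightarrow> 'l) \<Rightarrow> 'v \<Rightarrow> 'l" where
  "merge u v f = (\<lambda>w. if f w = f u then f v else f w)"

lemma labels_components_no_edges: "labels_components (G\<lparr>edges := {}\<rparr>) id"
  by (rule labels_componentsI) auto

lemma wf_subgraph: "wf_mgraph G \<Longrightarrow> F \<subseteq> edges G \<Longrightarrow> wf_mgraph (G\<lparr>edges := F\<rparr>)"
  by (auto simp: wf_mgraph_def intro: finite_subset)

text \<open>The union step of union-find: a new edge unites the classes of its two ends and no
  others, and \<open>merge\<close> does so by renaming one of them.\<close>

lemma labels_components_insert:
  assumes lab: "labels_components (G\<lparr>edges := F\<rparr>) f"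
    and wf: "wf_mgraph (G\<lparr>edges := F\<rparr>)"
    and e: "ends G e = {u, v}" "u \<in> verts G" "v \<in> verts G"
  shows "labels_components (G\<lparr>edges := insert e F\<rparr>) (merge u v f)"
proof (rule labels_componentsI)
  let ?G = "G\<lparr>edges := F\<rparr>" and ?H = "G\<lparr>edges := insert e F\<rparr>"
  have "adj ?G \<subseteq> adj ?H"
    by (auto simp: adj_def)
  then have mono: "(p, q) \<in> (adj ?G)\<^sup>* \<Longrightarrow> (p, q) \<in> (adj ?H)\<^sup>*" for p q
    using rtrancl_mono by blast
  have uv: "(u, v) \<in> (adj ?H)\<^sup>*"
    using e(1) by (intro adjI[of e]) auto
  have eq: "f p = f q \<Longrightarrow> (p, q) \<in> (adj ?H)\<^sup>*" if "p \<in> verts G" "q \<in> verts G" for p q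
    using lab that by (auto simp: labels_components_def intro: mono)
  fix p q
  show "merge u v f p = merge u v f q"
    if e': "e' \<in> edges ?H" "ends ?H e' = {p, q}" for e'
  proof (cases "e' \<in> F")
    case True
    \<comment> \<open>A labelling says nothing outside the vertex set, so well-formedness has to
      place the ends of an old edge inside it.\<close>
    with wf obtain p' q' where "p' \<in> verts G" "q' \<in> verts G" "{p', q'} = {p, q}"
      using e'(2) by (fastforce simp: wf_mgraph_def)
    then have "p \<in> verts G" "q \<in> verts G"
      by (auto simp: doubleton_eq_iff)
    moreover have "(p, q) \<in> (adj ?G)\<^sup>*"
      using True e'(2) by (intro adjI) auto
    ultimately have "f p = f q"
      using lab by (auto simp: labels_components_def)
    then show ?thesis
      by (simp add: merge_def)
  next
    case False
    with e' e(1) show ?thesis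
      by (auto simp: merge_def doubleton_eq_iff)
  qed
  show "(p, q) \<in> (adj ?H)\<^sup>*"
    if pq: "p \<in> verts ?H" "q \<in> verts ?H" "merge u v f p = merge u v f q"
  proof -
    have V: "p \<in> verts G" "q \<in> verts G"
      using pq by auto
    \<comment> \<open>Merged labels agree if the old ones did or if the old ones are those of
      \<open>u\<close> and \<open>v\<close>; in the latter cases the path runs through the new
      edge.\<close>
    consider "f p = f q" | "f p = f u" "f q = f v" | "f p = f v" "f q = f u"
      using pq(3) by (auto simp: merge_def split: if_splits)
    then show ?thesis
    proof cases
      case 1
      then show ?thesis using eq V by blast
    next
      case 2
      with V e have "(p, u) \<in> (adj ?H)\<^sup>*" "(v, q) \<in> (adj ?H)\<^sup>*"
        using eq by metis+
      then show ?thesis using uv by (meson rtrancl_trans)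
    next
      case 3
      with V e have "(p, v) \<in> (adj ?H)\<^sup>*" "(u, q) \<in> (adj ?H)\<^sup>*"
        using eq by metis+
      then show ?thesis using uv by (meson rtrancl_trans adj_rtrancl_sym)
    qed
  qed
qed

text \<open>Each inserted edge lowers the number of components by at most one. This makes the
  subtraction in \<open>nullity\<close> exact.\<close>

lemma card_verts_le:
  assumes "wf_mgraph G"
  shows "card (verts G) \<le> card (edges G) + card (conn_components G)"
proof -
  have "card (verts G) \<le> card F + card (conn_components (G\<lparr>edges := F\<rparr>))"
    if "finite F" "F \<subseteq> edges G" for F
    using that
  proof (induction F rule: finite_induct)
    case empty
    show ?case
      using card_conn_components[OF labels_components_no_edges[of G]] by simp
  next
    case (insert e F)
    obtain u v where uv: "u \<in> verts G" "v \<in> verts G" "ends G e = {u, v}"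
      using assms insert.prems by (auto simp: wf_mgraph_def)
    let ?f = "comp_of (G\<lparr>edges := F\<rparr>)"
    have "labels_components (G\<lparr>edges := insert e F\<rparr>) (merge u v ?f)"
      using uv insert.prems assms
      by (intro labels_components_insert labels_components_comp_of wf_subgraph) auto
    then have k: "card (conn_components (G\<lparr>edges := insert e F\<rparr>)) = card (merge u v ?f ` verts G)"
      using card_conn_components by fastforce
    have fin: "finite (verts G)"
      using assms by (simp add: wf_mgraph_def)
    \<comment> \<open>Only the label of \<open>u\<close> can disappear under
      \<open>merge\<close>.\<close>
    have "?f ` verts G - {?f u} \<subseteq> merge u v ?f ` verts G"
      by (auto simp: merge_def)
    then have "card (?f ` verts G - {?f u}) \<le> card (merge u v ?f ` verts G)"
      using fin by (intro card_mono) auto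
    then have "card (?f ` verts G) \<le> Suc (card (merge u v ?f ` verts G))"
      using uv fin by (simp add: card_Diff_singleton)
    moreover have "card (conn_components (G\<lparr>edges := F\<rparr>)) = card (?f ` verts G)"
      by (simp add: conn_components_eq)
    ultimately show ?case
      using insert k by auto
  qed
  from this[of "edges G"] show ?thesis
    using assms by (simp add: wf_mgraph_def)
qed

lemma card_conn_components_le: "finite (verts G) \<Longrightarrow> card (conn_components G) \<le> card (verts G)"
  by (simp add: conn_components_eq card_image_le)

text \<open>Turns sums over graphs into sums over edge sets, for which gluing is a
  bijection.\<close>

lemma spanning_subgraphs_eq:
  "spanning_subgraphs G = (\<lambda>F. G\<lparr>edges := F\<rparr>) ` Pow (edges G)"
proof (intro equalityI subsetI)
  fix H
  assume "H \<in> spanning_subgraphs G"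
  then have "H = G\<lparr>edges := edges H\<rparr>" "edges H \<in> Pow (edges G)"
    by (auto simp: spanning_subgraphs_def)
  then show "H \<in> (\<lambda>F. G\<lparr>edges := F\<rparr>) ` Pow (edges G)"
    by blast
qed (auto simp: spanning_subgraphs_def)

lemma inj_edges_update: "inj (\<lambda>F. G\<lparr>edges := F\<rparr>)"
  by (rule injI) (metis mgraph.select_convs(2) mgraph.surjective mgraph.update_convs(2))

section \<open>Gluing four copies\<close>

lemma UNIV_copy: "(UNIV :: copy set) = {C1, C2, C3, C4}"
  using copy.exhaust by auto

instance copy :: finite
  by standard (simp add: UNIV_copy)

definition wf_terminal :: "(vertex, 'e) mgraph \<Rightarrow> bool" where
  "wf_terminal G \<longleftrightarrow> wf_mgraph G \<and> VX \<in> verts G \<and> VY \<in> verts G"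

abbreviation linked :: "(vertex, 'e) mgraph \<Rightarrow> bool" where
  "linked H \<equiv> same_component H VX VY"

text \<open>For a spanning subgraph of a connected graph this is the exponent of
  \<open>varx - 1\<close> in its Tutte term, less one if the special vertices are separated. The
  division by \<open>varx - 1\<close> is thus carried out in advance.\<close>

definition free_components :: "(vertex, 'e) mgraph \<Rightarrow> nat" where
  "free_components H = card (conn_components H - {comp_of H VX, comp_of H VY})"

lemma card_components_free:
  assumes "wf_terminal H"
  shows "card (conn_components H) = free_components H + (if linked H then 1 else 2)"
proof -
  let ?S = "{comp_of H VX, comp_of H VY}"
  have sub: "?S \<subseteq> conn_components H" and fin: "finite (conn_components H)"
    using assms by (auto simp: wf_terminal_def wf_mgraph_def conn_components_eq)
  have "linked H \<longleftrightarrow> comp_of H VX = comp_of H VY"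
    using assms by (intro same_component_label labels_components_comp_of) (auto simp: wf_terminal_def)
  then have "card ?S = (if linked H then 1 else 2)"
    by auto
  moreover have "card (conn_components H) = free_components H + card ?S"
    unfolding free_components_def using sub fin
    by (metis card_Diff_subset card_mono finite_subset le_add_diff_inverse2)
  ultimately show ?thesis
    by simp
qed

section \<open>Vertices of the glued graph\<close>

lemma glue_inner: "v \<noteq> VX \<Longrightarrow> v \<noteq> VY \<Longrightarrow> glue i v = Inner i v"
  by (cases i; cases v) auto

definition specials :: "vertex set" where
  "specials = {VX, VY, VA, VB}"

lemma glue_special: "glue i VX \<in> specials" "glue i VY \<in> specials"
  by (cases i; simp add: specials_def)+

lemma special_glue:
  assumes "w \<in> specials" obtains i v where "v \<in> {VX, VY}" "w = glue i v"
proof -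
  have "\<exists>i. \<exists>v\<in>{VX, VY}. w = glue i v"
    using assms unfolding specials_def
    by (metis (no_types, lifting) glue.simps(1,3,5,7) insert_iff singletonD)
  with that show ?thesis by blast
qed

lemma verts_step:
  assumes "wf_terminal G"
  shows "verts (step G) = specials \<union> (\<Union>i. Inner i ` (verts G - {VX, VY}))"
proof (intro equalityI subsetI)
  fix w
  assume "w \<in> verts (step G)"
  then obtain i v where "v \<in> verts G" "w = glue i v"
    by (auto simp: step_def)
  then show "w \<in> specials \<union> (\<Union>i. Inner i ` (verts G - {VX, VY}))"
    using glue_special[of i] glue_inner[of v i] by (cases "v \<in> {VX, VY}") auto
next
  fix w
  assume "w \<in> specials \<union> (\<Union>i. Inner i ` (verts G - {VX, VY}))"
  then consider "w \<in> specials" | i v where "v \<in> verts G" "v \<noteq> VX" "v \<noteq> VY" "w = Inner i v"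
    by auto
  then have "\<exists>i. \<exists>v\<in>verts G. w = glue i v"
  proof cases
    case 1
    then show ?thesis
      using assms by (elim special_glue) (auto simp: wf_terminal_def)
  next
    case 2
    then show ?thesis using glue_inner by metis
  qed
  then show "w \<in> verts (step G)"
    by (auto simp: step_def)
qed

text \<open>The eight special vertices of the copies become four. The form with a sum avoids
  subtraction on \<open>nat\<close>.\<close>

lemma card_verts_step:
  assumes "wf_terminal G"
  shows "card (verts (step G)) + 4 = 4 * card (verts G)"
proof -
  let ?W = "verts G - {VX, VY}"
  have fin: "finite (verts G)" and sub: "{VX, VY} \<subseteq> verts G"
    using assms by (auto simp: wf_terminal_def wf_mgraph_def)
  have "card (\<Union>i. Inner i ` ?W) = (\<Sum>i\<in>UNIV. card (Inner i ` ?W))"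
    using fin by (intro card_UN_disjoint) auto
  also have "\<dots> = 4 * card ?W"
    by (simp add: UNIV_copy card_image inj_on_def)
  finally have "card (verts (step G)) = card specials + 4 * card ?W"
    unfolding verts_step[OF assms]
    using fin by (subst card_Un_disjoint) (auto simp: specials_def)
  moreover have "card ?W + 2 = card (verts G)"
    using fin sub card_mono[OF fin sub] by (simp add: card_Diff_subset)
  ultimately show ?thesis
    by (simp add: specials_def)
qed

lemma wf_terminal_step:
  assumes "wf_terminal G" shows "wf_terminal (step G)"
proof -
  have "wf_mgraph G"
    using assms by (simp add: wf_terminal_def)
  then have "finite (verts (step G))" "finite (edges (step G))"
    by (auto simp: step_def wf_mgraph_def)
  moreover have VA: "specials \<subseteq> verts (step G)"
    using verts_step[OF assms] by blast
  moreover have "\<exists>u\<in>verts (step G). \<exists>v\<in>verts (step G). ends (step G) e = {u, v}"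
    if "e \<in> edges (step G)" for e
  proof (cases "e = Added")
    case True
    then have "ends (step G) e = {VA, VB}"
      by (simp add: step_def)
    moreover have "VA \<in> verts (step G)" "VB \<in> verts (step G)"
      using VA by (auto simp: specials_def)
    ultimately show ?thesis by blast
  next
    case False
    with that obtain i e' where e: "e = Copied i e'" "e' \<in> edges G"
      by (auto simp: step_def)
    then obtain u v where "u \<in> verts G" "v \<in> verts G" "ends G e' = {u, v}"
      using \<open>wf_mgraph G\<close> by (auto simp: wf_mgraph_def)
    with e have "glue i u \<in> verts (step G)" "glue i v \<in> verts (step G)"
      "ends (step G) e = {glue i u, glue i v}"
      by (auto simp: step_def)
    then show ?thesis by blast
  qed
  ultimately show ?thesis
    by (auto simp: wf_terminal_def wf_mgraph_def specials_def)
qed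

section \<open>Glued edge sets and skeletons\<close>

definition glue_edges :: "(copy \<Rightarrow> edge set) \<Rightarrow> bool \<Rightarrow> edge set" where
  "glue_edges F d = (\<Union>i. Copied i ` F i) \<union> {e. d \<and> e = Added}"

text \<open>The edge \<open>Some i\<close> stands for copy \<open>i\<close> and \<open>None\<close>
  for the added edge. Being a graph on the same vertex type, the skeleton has its own
  \<open>linked\<close>, \<open>free_components\<close> and \<open>nullity\<close>.\<close>

definition skeleton :: "(copy \<Rightarrow> bool) \<Rightarrow> bool \<Rightarrow> (vertex, copy option) mgraph" where
  "skeleton s d =
     \<lparr>verts = specials,
      edges = Some ` {i. s i} \<union> {e. d \<and> e = None},
      ends = (\<lambda>e. case e of None \<Rightarrow> {VA, VB} | Some i \<Rightarrow> {glue i VX, glue i VY})\<rparr>"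

lemma verts_skeleton [simp]: "verts (skeleton s d) = specials"
  by (simp add: skeleton_def)

lemma card_glue_edges:
  assumes "\<And>i. finite (F i)"
  shows "card (glue_edges F d) = (\<Sum>i\<in>UNIV. card (F i)) + of_bool d"
proof -
  have "card (\<Union>i. Copied i ` F i) = (\<Sum>i\<in>UNIV. card (Copied i ` F i))"
    using assms by (intro card_UN_disjoint) auto
  also have "\<dots> = (\<Sum>i\<in>UNIV. card (F i))"
    by (simp add: card_image inj_on_def)
  finally show ?thesis
    unfolding glue_edges_def using assms by (subst card_Un_disjoint) auto
qed

lemma wf_skeleton: "wf_terminal (skeleton t d)"
proof -
  have "\<exists>u\<in>specials. \<exists>v\<in>specials. ends (skeleton t d) e = {u, v}" for e
  proof (cases e)
    case None
    then have "ends (skeleton t d) e = {VA, VB}"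
      by (simp add: skeleton_def)
    moreover have "VA \<in> specials" "VB \<in> specials"
      by (simp_all add: specials_def)
    ultimately show ?thesis by blast
  next
    case (Some i)
    then have "ends (skeleton t d) e = {glue i VX, glue i VY}"
      by (simp add: skeleton_def)
    then show ?thesis
      using glue_special by blast
  qed
  then show ?thesis
    by (simp add: wf_terminal_def wf_mgraph_def) (simp add: specials_def)
qed

lemma card_edges_skeleton:
  "card (edges (skeleton t d)) =
     of_bool (t C1) + of_bool (t C2) + of_bool (t C3) + of_bool (t C4) + of_bool d"
proof -
  have "card (edges (skeleton t d)) = card {i. t i} + of_bool d"
    unfolding skeleton_def by (auto simp: card_image card_insert_if)
  also have "card {i. t i} = (\<Sum>i\<in>UNIV. of_bool (t i))"
    by simp
  also have "\<dots> = of_bool (t C1) + of_bool (t C2) + of_bool (t C3) + of_bool (t C4)"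
    by (simp add: UNIV_copy del: sum_of_bool_eq)
  finally show ?thesis .
qed

section \<open>Components and nullity of a glued subgraph\<close>

locale glued =
  fixes G :: "(vertex, edge) mgraph" and F :: "copy \<Rightarrow> edge set" and d :: bool
  assumes G: "wf_terminal G" and F: "\<And>i. F i \<subseteq> edges G"
begin

abbreviation "part i \<equiv> G\<lparr>edges := F i\<rparr>"
abbreviation "whole \<equiv> (step G)\<lparr>edges := glue_edges F d\<rparr>"
abbreviation "skel \<equiv> skeleton (\<lambda>i. linked (part i)) d"

lemma wf_part: "wf_terminal (part i)"
  using G F by (auto simp: wf_terminal_def intro: wf_subgraph)

lemma glue_edges_subset: "glue_edges F d \<subseteq> edges (step G)"
  using F by (auto simp: glue_edges_def step_def)

lemma wf_whole: "wf_terminal whole"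
  using wf_terminal_step[OF G] glue_edges_subset by (auto simp: wf_terminal_def intro: wf_subgraph)

lemma part_whole:
  assumes "(u, v) \<in> (adj (part i))\<^sup>*"
  shows "(glue i u, glue i v) \<in> (adj whole)\<^sup>*"
  using assms
proof induction
  case (step v w)
  then obtain e where e: "e \<in> F i" "ends G e = {v, w}"
    by (auto simp: adj_def)
  have "(glue i v, glue i w) \<in> (adj whole)\<^sup>*"
    using e by (intro adjI[of "Copied i e"]) (auto simp: glue_edges_def step_def)
  with step.IH show ?case by (meson rtrancl_trans)
qed simp

text \<open>The skeleton edge of copy \<open>i\<close> is present only if that part connects its
  special vertices, so it can be replaced by a path inside the copy.\<close>

lemma skeleton_whole:
  assumes "(u, v) \<in> (adj skel)\<^sup>*"
  shows "(u, v) \<in> (adj whole)\<^sup>*"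
  using assms
proof induction
  case (step v w)
  then obtain e where e: "e \<in> edges skel" "ends skel e = {v, w}"
    by (auto simp: adj_def)
  have "(v, w) \<in> (adj whole)\<^sup>*"
  proof (cases e)
    case None
    with e show ?thesis
      by (intro adjI[of Added]) (auto simp: skeleton_def glue_edges_def step_def)
  next
    case (Some i)
    with e have "linked (part i)" "{v, w} = {glue i VX, glue i VY}"
      by (auto simp: skeleton_def)
    moreover from this have "(VX, VY) \<in> (adj (part i))\<^sup>*"
      using wf_part[of i] same_component_iff[of VX "part i" VY] by (simp add: wf_terminal_def)
    then have "(glue i VX, glue i VY) \<in> (adj whole)\<^sup>*"
      by (rule part_whole)
    ultimately show ?thesis
      unfolding doubleton_eq_iff using adj_rtrancl_sym by metis
  qed
  with step.IH show ?case by (meson rtrancl_trans)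
qed simp

text \<open>
  The left summand holds the components of the skeleton, the right one the components of the
  copies that avoid the special vertices.
\<close>

definition part_label :: "copy \<Rightarrow> vertex \<Rightarrow> vertex set + copy \<times> vertex set" where
  "part_label i v =
     (if comp_of (part i) v = comp_of (part i) VX then Inl (comp_of skel (glue i VX))
      else if comp_of (part i) v = comp_of (part i) VY then Inl (comp_of skel (glue i VY))
      else Inr (i, comp_of (part i) v))"

fun label :: "vertex \<Rightarrow> vertex set + copy \<times> vertex set" where
  "label (Inner i v) = part_label i v"
| "label w = Inl (comp_of skel w)"

lemma label_special: "w \<in> specials \<Longrightarrow> label w = Inl (comp_of skel w)"
  by (auto simp: specials_def)

text \<open>Consistency of \<open>part_label\<close>: if both special vertices of a copy share a
  component, the first case applies to both, and their skeleton labels have to agree.\<close>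

lemma comp_of_skel:
  assumes "comp_of (part i) VX = comp_of (part i) VY"
  shows "comp_of skel (glue i VX) = comp_of skel (glue i VY)"
proof -
  have "linked (part i)"
    using assms same_component_label[OF labels_components_comp_of, of VX "part i" VY] wf_part[of i]
    by (simp add: wf_terminal_def)
  then have "(glue i VX, glue i VY) \<in> (adj skel)\<^sup>*"
    by (intro adjI[of "Some i"]) (auto simp: skeleton_def)
  then show ?thesis
    using labels_components_comp_of[of skel] glue_special[of i]
    by (simp add: labels_components_def)
qed

text \<open>Shows that \<open>label\<close> respects the identifications: it can be computed from
  any copy in which the vertex occurs.\<close>

lemma label_glue: "label (glue i v) = part_label i v"
proof (cases "v \<in> {VX, VY}")
  case True
  then show ?thesis
    using comp_of_skel[of i] glue_special[of i] label_special
    by (auto simp: part_label_def)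
next
  case False
  then show ?thesis
    using glue_inner[of v i] by simp
qed

text \<open>A label from the left summand arises only if \<open>v\<close> is connected inside its
  part to a special vertex of the copy; the image of that vertex is the witness.\<close>

lemma part_label_Inl:
  assumes "v \<in> verts G" "part_label i v = Inl c"
  obtains u where "u \<in> specials" "c = comp_of skel u" "(glue i v, u) \<in> (adj whole)\<^sup>*"
proof -
  obtain t where t: "t \<in> {VX, VY}" "comp_of (part i) v = comp_of (part i) t"
    "c = comp_of skel (glue i t)"
    using assms(2) by (auto simp: part_label_def split: if_splits)
  moreover have "(v, t) \<in> (adj (part i))\<^sup>*"
    using labels_components_comp_of[of "part i"] t assms(1) G
    by (auto simp: labels_components_def wf_terminal_def)
  ultimately show ?thesis
    using that[of "glue i t"] part_whole glue_special[of i] by auto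
qed

lemma labels_components_label: "labels_components whole label"
proof (rule labels_componentsI)
  fix p q e
  assume e: "e \<in> edges whole" "ends whole e = {p, q}"
  show "label p = label q"
  proof (cases "e = Added")
    case True
    with e have d "{p, q} = {VA, VB}"
      by (auto simp: glue_edges_def step_def)
    moreover from this have "(VA, VB) \<in> (adj skel)\<^sup>*"
      by (intro adjI[of None]) (auto simp: skeleton_def)
    then have "comp_of skel VA = comp_of skel VB"
      using labels_components_comp_of[of skel]
      by (simp add: labels_components_def specials_def)
    ultimately show ?thesis
      unfolding doubleton_eq_iff using label.simps(4,5) by metis
  next
    case False
    with e(1) obtain i e' where e': "e = Copied i e'" "e' \<in> F i"
      by (auto simp: glue_edges_def)
    obtain u v where uv: "u \<in> verts G" "v \<in> verts G" "ends G e' = {u, v}"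
      using e' wf_part[of i] by (auto simp: wf_terminal_def wf_mgraph_def)
    have "(u, v) \<in> (adj (part i))\<^sup>*"
      using e' uv by (intro adjI[of e']) auto
    then have "comp_of (part i) u = comp_of (part i) v"
      using labels_components_comp_of[of "part i"] uv by (simp add: labels_components_def)
    then have "part_label i u = part_label i v"
      by (simp add: part_label_def)
    moreover have "{p, q} = {glue i u, glue i v}"
      using e(2) e' uv by (simp add: step_def)
    ultimately show ?thesis
      by (auto simp: doubleton_eq_iff label_glue)
  qed
next
  fix p q
  assume "p \<in> verts whole" "q \<in> verts whole" and eq: "label p = label q"
  then obtain i u j v where
    p: "p = glue i u" "u \<in> verts G" and q: "q = glue j v" "v \<in> verts G"
    by (auto simp: step_def)
  have eq': "part_label i u = part_label j v"
    using eq p q by (simp add: label_glue)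
  show "(p, q) \<in> (adj whole)\<^sup>*"
  proof (cases "part_label i u")
    \<comment> \<open>Both vertices reach skeleton vertices of a common skeleton component, and a
      lifted skeleton path closes the gap.\<close>
    case (Inl c)
    obtain s where s: "s \<in> specials" "c = comp_of skel s" "(p, s) \<in> (adj whole)\<^sup>*"
      using part_label_Inl[OF p(2) Inl] p by blast
    obtain t where t: "t \<in> specials" "c = comp_of skel t" "(q, t) \<in> (adj whole)\<^sup>*"
      using part_label_Inl[OF q(2), of j c] Inl eq' q by auto
    have "comp_of skel s = comp_of skel t"
      using s(2) t(2) by simp
    with s(1) t(1) have "(s, t) \<in> (adj skel)\<^sup>*"
      using labels_components_comp_of[of skel] by (simp add: labels_components_def)
    from skeleton_whole[OF this] show ?thesis
      using s(3) t(3) by (meson adj_rtrancl_sym rtrancl_trans)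
  next
    \<comment> \<open>The label records the copy, so both vertices lie in one component of one
      part.\<close>
    case (Inr c)
    with eq' have "i = j" "comp_of (part i) u = comp_of (part i) v"
      by (auto simp: part_label_def split: if_splits)
    then show ?thesis
      using p q labels_components_comp_of[of "part i"] part_whole
      by (auto simp: labels_components_def)
  qed
qed

text \<open>The labels form a disjoint sum, so counting them adds the components of the skeleton and
  the free components of the parts.\<close>

lemma label_image:
  "label ` verts whole =
     Inl ` conn_components skel \<union>
     Inr ` (SIGMA i:UNIV. conn_components (part i) - {comp_of (part i) VX, comp_of (part i) VY})"
  (is "?L = ?A \<union> ?B")
proof
  show "?L \<subseteq> ?A \<union> ?B"
  proof
    fix l
    assume "l \<in> ?L"
    then obtain i v where "v \<in> verts G" "l = part_label i v"
      by (auto simp: step_def label_glue)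
    then show "l \<in> ?A \<union> ?B"
      using glue_special[of i] by (auto simp: part_label_def conn_components_eq)
  qed
  have "?A \<subseteq> ?L"
  proof
    fix l
    assume "l \<in> ?A"
    then obtain w where "w \<in> specials" "l = label w"
      using label_special by (auto simp: conn_components_eq)
    then show "l \<in> ?L"
      using verts_step[OF G] by auto
  qed
  moreover have "?B \<subseteq> ?L"
  proof
    fix l
    assume "l \<in> ?B"
    then obtain i v where "v \<in> verts G" "l = Inr (i, comp_of (part i) v)"
      "comp_of (part i) v \<noteq> comp_of (part i) VX" "comp_of (part i) v \<noteq> comp_of (part i) VY"
      by (simp add: conn_components_eq image_iff) blast
    then have "v \<in> verts G" "l = part_label i v"
      by (simp_all add: part_label_def)
    then have "l = label (glue i v)" "glue i v \<in> verts whole"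
      by (auto simp: label_glue step_def)
    then show "l \<in> ?L" by blast
  qed
  ultimately show "?A \<union> ?B \<subseteq> ?L" by blast
qed

lemma card_components_whole:
  "card (conn_components whole) =
     card (conn_components skel) + (\<Sum>i\<in>UNIV. free_components (part i))"
proof -
  have fin: "finite (conn_components skel)" "finite (conn_components (part i))" for i
    using wf_part[of i]
    by (auto simp: conn_components_eq specials_def wf_terminal_def wf_mgraph_def)
  show ?thesis
    unfolding card_conn_components[OF labels_components_label] label_image free_components_def
    using fin by (subst card_Un_disjoint) (auto simp: card_image inj_on_def)
qed

lemma linked_whole: "linked whole \<longleftrightarrow> same_component skel VX VY"
proof -
  have "linked whole \<longleftrightarrow> label VX = label VY"
    using wf_whole by (intro same_component_label labels_components_label) (auto simp: wf_terminal_def)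
  also have "\<dots> \<longleftrightarrow> comp_of skel VX = comp_of skel VY"
    by simp
  also have "\<dots> \<longleftrightarrow> same_component skel VX VY"
    by (intro same_component_label[symmetric] labels_components_comp_of)
       (simp_all add: specials_def)
  finally show ?thesis .
qed

text \<open>The whole graph and its skeleton connect \<open>VX\<close> and \<open>VY\<close> alike,
  so both component counts exceed the free ones by the same 1 or 2.\<close>

lemma free_components_whole:
  "free_components whole = free_components skel + (\<Sum>i\<in>UNIV. free_components (part i))"
  using card_components_whole card_components_free[OF wf_whole] card_components_free[OF wf_skeleton]
  by (simp add: linked_whole)

text \<open>Nullity is edges minus vertices plus components, and all these counts are known. A
  connection between its special vertices costs a part one component, which is compensated by the
  corresponding skeleton edge.\<close>

lemma nullity_whole: "nullity whole = nullity skel + (\<Sum>i\<in>UNIV. nullity (part i))"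
proof -
  \<comment> \<open>Rearranged without subtraction, so that the final step is linear
    arithmetic.\<close>
  have null: "nullity H + card (verts H) = card (edges H) + card (conn_components H)"
    if "wf_terminal H" for H :: "(vertex, 'e) mgraph"
    using card_verts_le[of H] that by (simp add: nullity_def wf_terminal_def)
  have part: "nullity (part i) + card (verts G) + of_bool (linked (part i))
      = card (F i) + free_components (part i) + 2" for i
    using null[OF wf_part[of i]] card_components_free[OF wf_part[of i]] by simp
  have "finite (F i)" for i
    using G F[of i] by (auto simp: wf_terminal_def wf_mgraph_def intro: finite_subset)
  then have whole: "nullity whole + card (verts (step G)) =
      (\<Sum>i\<in>UNIV. card (F i)) + of_bool d + card (conn_components whole)"
    using null[OF wf_whole] by (simp add: card_glue_edges)
  have "card (verts skel) = 4"
    by (simp add: specials_def)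
  then have skel: "nullity skel + 4 =
      of_bool (linked (part C1)) + of_bool (linked (part C2)) + of_bool (linked (part C3))
      + of_bool (linked (part C4)) + of_bool d + card (conn_components skel)"
    using null[OF wf_skeleton[of "\<lambda>i. linked (part i)" d]] by (simp only: card_edges_skeleton)
  show ?thesis
    using whole skel card_components_whole card_verts_step[OF G]
      part[of C1] part[of C2] part[of C3] part[of C4]
    by (simp add: UNIV_copy)
qed

end

section \<open>Partial sums of the Tutte polynomial\<close>

definition weight :: "(vertex, 'e) mgraph \<Rightarrow> int poly poly" where
  "weight H = (varx - 1) ^ free_components H * (vary - 1) ^ nullity H"

text \<open>For \<open>Gr n\<close> the argument \<open>True\<close> will give \<open>T1 n\<close>,
  and \<open>False\<close> will give \<open>N n\<close> itself rather than \<open>T2 n\<close>, so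
  the recursion involves no division.\<close>

definition partial_sum :: "(vertex, edge) mgraph \<Rightarrow> bool \<Rightarrow> int poly poly" where
  "partial_sum G b =
     (\<Sum>F\<in>{F \<in> Pow (edges G). linked (G\<lparr>edges := F\<rparr>) = b}. weight (G\<lparr>edges := F\<rparr>))"

lemma (in glued) weight_whole: "weight whole = weight skel * (\<Prod>i\<in>UNIV. weight (part i))"
  by (simp add: weight_def free_components_whole nullity_whole power_add power_sum prod.distrib)

text \<open>An edge set of the glued graph amounts to four edge sets and one truth value. Grouped by
  the copies that are linked, the skeleton weight factors out and a product of four sums
  remains.\<close>

lemma partial_sum_step:
  assumes "wf_terminal G"
  shows "partial_sum (step G) b =
    (\<Sum>(s, d)\<in>{(s, d). linked (skeleton s d) = b}.
       weight (skeleton s d) * (\<Prod>i\<in>UNIV. partial_sum G (s i)))"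
proof -
  define S where "S c = {F \<in> Pow (edges G). linked (G\<lparr>edges := F\<rparr>) = c}" for c
  let ?P = "{(s, d). linked (skeleton s d) = b}"
  let ?w = "\<lambda>F. weight (G\<lparr>edges := F\<rparr>)"
  have "finite (edges G)"
    using assms by (simp add: wf_terminal_def wf_mgraph_def)
  then have fin: "finite (S c)" for c
    by (simp add: S_def)
  \<comment> \<open>Distributivity: a product of sums is a sum over families of edge sets.\<close>
  have prod_partial: "(\<Prod>i\<in>UNIV. partial_sum G (s i)) =
      (\<Sum>F\<in>Pi\<^sub>E UNIV (\<lambda>i. S (s i)). \<Prod>i\<in>UNIV. ?w (F i))" for s :: "copy \<Rightarrow> bool"
    unfolding partial_sum_def S_def[symmetric] using fin by (intro prod_sum_PiE) auto
  have glued: "glued G F" if "\<And>i. F i \<subseteq> edges G" for F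
    using assms that by unfold_locales
  have split: "E \<subseteq> edges (step G) \<Longrightarrow> glue_edges (\<lambda>i. {e. Copied i e \<in> E}) (Added \<in> E) = E" for E
    by (auto simp: glue_edges_def step_def)
  have sub: "E \<subseteq> edges (step G) \<Longrightarrow> {e. Copied i e \<in> E} \<subseteq> edges G" for E i
    by (auto simp: step_def)
  have "partial_sum (step G) b =
    (\<Sum>(p, F)\<in>(SIGMA p:?P. Pi\<^sub>E UNIV (\<lambda>i. S (fst p i))).
       weight (skeleton (fst p) (snd p)) * (\<Prod>i\<in>UNIV. ?w (F i)))"
    unfolding partial_sum_def
  \<comment> \<open>One map glues a family; its inverse reads off from \<open>E\<close> the trace on
    each copy, which traces link the special vertices, and whether \<open>Added\<close>
    occurs.\<close>
  proof (rule sum.reindex_bij_witness[where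
      i = "\<lambda>(p, F). glue_edges F (snd p)" and
      j = "\<lambda>E. let F = (\<lambda>i. {e. Copied i e \<in> E}) in
             ((\<lambda>i. linked (G\<lparr>edges := F i\<rparr>), Added \<in> E), F)"])
    fix E
    assume E: "E \<in> {E \<in> Pow (edges (step G)). linked ((step G)\<lparr>edges := E\<rparr>) = b}"
    define F where "F = (\<lambda>i. {e. Copied i e \<in> E})"
    have Fsub: "F i \<subseteq> edges G" for i
      using E sub by (auto simp: F_def)
    interpret glued G F "Added \<in> E"
      using glued Fsub .
    have EF: "glue_edges F (Added \<in> E) = E"
      using E split by (simp add: F_def)
    show "(case let F = \<lambda>i. {e. Copied i e \<in> E}
        in ((\<lambda>i. linked (G\<lparr>edges := F i\<rparr>), Added \<in> E), F) of
        (p, F) \<Rightarrow> glue_edges F (snd p)) = E"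
      using EF by (simp add: F_def)
    have "((\<lambda>i. linked (part i), Added \<in> E), F) \<in> (SIGMA p:?P. Pi\<^sub>E UNIV (\<lambda>i. S (fst p i)))"
      using E linked_whole Fsub by (auto simp: EF S_def)
    then show "(let F = \<lambda>i. {e. Copied i e \<in> E}
        in ((\<lambda>i. linked (G\<lparr>edges := F i\<rparr>), Added \<in> E), F))
        \<in> (SIGMA p:?P. Pi\<^sub>E UNIV (\<lambda>i. S (fst p i)))"
      by (simp add: F_def Let_def)
    show "(case let F = \<lambda>i. {e. Copied i e \<in> E}
        in ((\<lambda>i. linked (G\<lparr>edges := F i\<rparr>), Added \<in> E), F) of
        (p, F) \<Rightarrow> weight (skeleton (fst p) (snd p)) * (\<Prod>i\<in>UNIV. ?w (F i)))
        = weight ((step G)\<lparr>edges := E\<rparr>)"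
      using weight_whole by (simp add: EF) (simp add: F_def Let_def)
  next
    fix q
    assume "q \<in> (SIGMA p:?P. Pi\<^sub>E UNIV (\<lambda>i. S (fst p i)))"
    then obtain s d F where q: "q = ((s, d), F)" "linked (skeleton s d) = b"
      "\<And>i. F i \<subseteq> edges G" "\<And>i. linked (G\<lparr>edges := F i\<rparr>) = s i"
      by (auto simp: S_def PiE_UNIV_domain Pi_iff)
    interpret glued G F d
      using glued q(3) .
    show "(case q of (p, F) \<Rightarrow> glue_edges F (snd p))
        \<in> {E \<in> Pow (edges (step G)). linked ((step G)\<lparr>edges := E\<rparr>) = b}"
      using glue_edges_subset linked_whole q by simp
    have "(\<lambda>i. {e. Copied i e \<in> glue_edges F d}) = F" "(Added \<in> glue_edges F d) = d"
      by (auto simp: glue_edges_def)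
    then show "(let F = \<lambda>i. {e. Copied i e \<in> (case q of (p, F) \<Rightarrow> glue_edges F (snd p))}
        in ((\<lambda>i. linked (G\<lparr>edges := F i\<rparr>), Added \<in> (case q of (p, F) \<Rightarrow> glue_edges F (snd p))), F)) = q"
      using q by (simp add: Let_def)
  qed
  also have "\<dots> = (\<Sum>p\<in>?P. \<Sum>F\<in>Pi\<^sub>E UNIV (\<lambda>i. S (fst p i)).
       weight (skeleton (fst p) (snd p)) * (\<Prod>i\<in>UNIV. ?w (F i)))"
    using fin by (intro sum.Sigma[symmetric]) (auto intro: finite_PiE)
  also have "\<dots> = (\<Sum>p\<in>?P. weight (skeleton (fst p) (snd p)) *
       (\<Prod>i\<in>UNIV. partial_sum G (fst p i)))"
    by (simp add: sum_distrib_left[symmetric] prod_partial)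
  finally show ?thesis
    by (simp add: case_prod_beta)
qed

section \<open>Evaluation of the 32 skeletons\<close>

lemma labels_components_insert_if:
  assumes "labels_components (G\<lparr>edges := F\<rparr>) f" "wf_mgraph (G\<lparr>edges := F\<rparr>)"
    and "b \<Longrightarrow> ends G e = {u, v} \<and> u \<in> verts G \<and> v \<in> verts G"
  shows "labels_components (G\<lparr>edges := F \<union> {x. b \<and> x = e}\<rparr>) (if b then merge u v f else f)"
  using labels_components_insert[of F G f e u v] assms by (cases b) auto

text \<open>
  A union-find computation; the arguments tell which of the four copies and whether the added
  edge are present.
\<close>

definition skeleton_label :: "bool \<Rightarrow> bool \<Rightarrow> bool \<Rightarrow> bool \<Rightarrow> bool \<Rightarrow> vertex \<Rightarrow> vertex" where
  "skeleton_label p q r t d =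
     (let f0 = id;
          f1 = (if p then merge VX VA f0 else f0);
          f2 = (if q then merge VX VB f1 else f1);
          f3 = (if r then merge VA VY f2 else f2);
          f4 = (if t then merge VB VY f3 else f3)
      in if d then merge VA VB f4 else f4)"

lemma labels_components_skeleton:
  "labels_components (skeleton (case_copy p q r t) d) (skeleton_label p q r t d)"
proof -
  \<comment> \<open>Skeletons differ only in their edges, so each is a subgraph of the full one and
    arises by five conditional insertions.\<close>
  let ?K = "skeleton (\<lambda>_. True) True"
  let ?E = "\<lambda>b x. {y. b \<and> y = x}"
  have wf: "wf_mgraph (?K\<lparr>edges := F\<rparr>)" for F
  proof (rule wf_subgraph)
    show "wf_mgraph ?K"
      using wf_skeleton by (simp add: wf_terminal_def)
    show "F \<subseteq> edges ?K"
      by (simp add: skeleton_def UNIV_option_conv[symmetric])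
  qed
  have "edges (skeleton (case_copy p q r t) d) =
      {} \<union> ?E p (Some C1) \<union> ?E q (Some C2) \<union> ?E r (Some C3) \<union> ?E t (Some C4) \<union> ?E d None"
    by (auto simp: skeleton_def split: copy.splits)
  then have eq: "skeleton (case_copy p q r t) d = ?K\<lparr>edges :=
      {} \<union> ?E p (Some C1) \<union> ?E q (Some C2) \<union> ?E r (Some C3) \<union> ?E t (Some C4) \<union> ?E d None\<rparr>"
    by (simp add: skeleton_def)
  show ?thesis
    unfolding eq skeleton_label_def Let_def
    by (intro labels_components_insert_if labels_components_no_edges wf)
       (simp_all add: skeleton_def specials_def)
qed

text \<open>With explicit union-find labels on four vertices, simplification can evaluate every
  skeleton weight.\<close>

lemma weight_skeleton:
  fixes p q r t d
  defines "s \<equiv> case_copy p q r t" and "f \<equiv> skeleton_label p q r t d"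
  shows "linked (skeleton s d) \<longleftrightarrow> f VX = f VY"
    and "weight (skeleton s d) =
      (varx - 1) ^ (card (f ` specials) - (if f VX = f VY then 1 else 2)) *
      (vary - 1) ^ (of_bool p + of_bool q + of_bool r + of_bool t + of_bool d
                    + card (f ` specials) - 4)"
proof -
  have lab: "labels_components (skeleton s d) f"
    unfolding s_def f_def by (rule labels_components_skeleton)
  show linked: "linked (skeleton s d) \<longleftrightarrow> f VX = f VY"
    using lab by (rule same_component_label) (simp_all add: specials_def)
  have k: "card (conn_components (skeleton s d)) = card (f ` specials)"
    using card_conn_components[OF lab] by simp
  then have free: "free_components (skeleton s d) =
      card (f ` specials) - (if f VX = f VY then 1 else 2)"
    using card_components_free[OF wf_skeleton, of s d] linked by auto
  have "card (edges (skeleton s d)) = of_bool p + of_bool q + of_bool r + of_bool t + of_bool d"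
    unfolding card_edges_skeleton s_def by simp
  moreover have "card (verts (skeleton s d)) = 4"
    by (simp add: specials_def)
  ultimately show "weight (skeleton s d) =
      (varx - 1) ^ (card (f ` specials) - (if f VX = f VY then 1 else 2)) *
      (vary - 1) ^ (of_bool p + of_bool q + of_bool r + of_bool t + of_bool d
                    + card (f ` specials) - 4)"
    by (simp only: weight_def nullity_def free k)
qed

text \<open>Prepares the enumeration: a pattern of linked copies is four independent truth
  values.\<close>

lemma sum_copy_bool:
  fixes h :: "(copy \<Rightarrow> bool) \<Rightarrow> 'a::comm_monoid_add"
  shows "(\<Sum>s\<in>UNIV. h s) =
    (\<Sum>p\<in>UNIV. \<Sum>q\<in>UNIV. \<Sum>r\<in>UNIV. \<Sum>t\<in>UNIV. h (case_copy p q r t))"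
proof -
  have eta: "case_copy (s C1) (s C2) (s C3) (s C4) = s" for s :: "copy \<Rightarrow> bool"
    by (rule ext) (simp split: copy.split)
  have "(\<Sum>s\<in>UNIV. h s) = (\<Sum>(p, q, r, t)\<in>UNIV. h (case_copy p q r t))"
    by (rule sum.reindex_bij_witness[where
        i = "\<lambda>(p, q, r, t). case_copy p q r t" and j = "\<lambda>s. (s C1, s C2, s C3, s C4)"])
       (simp_all add: eta split: prod.split)
  also have "\<dots> = (\<Sum>p\<in>UNIV. \<Sum>q\<in>UNIV. \<Sum>r\<in>UNIV. \<Sum>t\<in>UNIV. h (case_copy p q r t))"
    by (simp add: UNIV_Times_UNIV[symmetric] sum.cartesian_product del: UNIV_Times_UNIV)
  finally show ?thesis .
qed

lemma partial_sum_recursion: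
  assumes "wf_terminal G"
  defines "A \<equiv> partial_sum G True" and "B \<equiv> partial_sum G False"
  shows "partial_sum (step G) True =
      vary * (vary - 1) * A ^ 4 + 4 * vary * A ^ 3 * B + (2 * varx + 2) * A ^ 2 * B ^ 2"
    and "partial_sum (step G) False =
      (2 * vary + 2) * A ^ 2 * B ^ 2 + 4 * varx * A * B ^ 3 + varx * (varx - 1) * B ^ 4"
proof -
  have eq: "partial_sum (step G) b =
    (\<Sum>p\<in>UNIV. \<Sum>q\<in>UNIV. \<Sum>r\<in>UNIV. \<Sum>t\<in>UNIV. \<Sum>d\<in>UNIV.
       if linked (skeleton (case_copy p q r t) d) = b
       then weight (skeleton (case_copy p q r t) d) *
         (partial_sum G p * partial_sum G q * partial_sum G r * partial_sum G t) else 0)" for b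
  proof -
    have "partial_sum (step G) b =
      (\<Sum>(s, d)\<in>UNIV. if linked (skeleton s d) = b
         then weight (skeleton s d) * (\<Prod>i\<in>UNIV. partial_sum G (s i)) else 0)"
      unfolding partial_sum_step[OF assms(1)]
      by (rule sum.mono_neutral_cong_left) (simp_all add: case_prod_beta)
    also have "\<dots> = (\<Sum>s\<in>UNIV. \<Sum>d\<in>UNIV. if linked (skeleton s d) = b
         then weight (skeleton s d) * (\<Prod>i\<in>UNIV. partial_sum G (s i)) else 0)"
      by (simp add: UNIV_Times_UNIV[symmetric] sum.cartesian_product del: UNIV_Times_UNIV)
    finally show ?thesis
      unfolding sum_copy_bool by (simp add: UNIV_copy mult.assoc cong: if_cong)
  qed
  note eval = eq UNIV_bool weight_skeleton skeleton_label_def merge_def specials_def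
    Let_def card_insert_if A_def[symmetric] B_def[symmetric]
  show "partial_sum (step G) True =
      vary * (vary - 1) * A ^ 4 + 4 * vary * A ^ 3 * B + (2 * varx + 2) * A ^ 2 * B ^ 2"
    \<comment> \<open>Each linked copy contributes \<open>A\<close> and each other copy
      \<open>B\<close>. For example, the four-cycle without and with its chord yields
      \<open>(vary - 1) + (vary - 1) ^ 2 = vary * (vary - 1)\<close> for
      \<open>A ^ 4\<close>.\<close>
    by (simp add: eval) (simp add: algebra_simps power2_eq_square power3_eq_cube power4_eq_xxxx)
  show "partial_sum (step G) False =
      (2 * vary + 2) * A ^ 2 * B ^ 2 + 4 * varx * A * B ^ 3 + varx * (varx - 1) * B ^ 4"
    \<comment> \<open>If no copy is linked, \<open>VA\<close> and \<open>VB\<close> form two free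
      components or, joined by the added edge, one; hence
      \<open>(varx - 1) ^ 2 + (varx - 1) = varx * (varx - 1)\<close> for
      \<open>B ^ 4\<close>.\<close>
    by (simp add: eval) (simp add: algebra_simps power2_eq_square power3_eq_cube power4_eq_xxxx)
qed

section \<open>The sequence of graphs\<close>

lemma wf_terminal_K2: "wf_terminal K2"
  by (simp add: wf_terminal_def wf_mgraph_def K2_def)

lemma wf_terminal_Gr: "wf_terminal (Gr n)"
  by (induction n) (simp_all add: wf_terminal_K2 wf_terminal_step)

lemma partial_sum_K2: "partial_sum K2 True = 1" "partial_sum K2 False = 1"
proof -
  let ?E = "K2\<lparr>edges := {}\<rparr>" and ?F = "K2\<lparr>edges := {Initial}\<rparr>"
  have wf: "wf_terminal ?E" "wf_terminal ?F"
    by (simp_all add: wf_terminal_def wf_mgraph_def K2_def)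
  have labE: "labels_components ?E id"
    by (rule labels_components_no_edges)
  then have labF: "labels_components ?F (merge VX VY id)"
    by (rule labels_components_insert) (use wf in \<open>simp_all add: wf_terminal_def K2_def\<close>)
  have linked: "\<not> linked ?E" "linked ?F"
    using same_component_label[OF labE, of VX VY] same_component_label[OF labF, of VX VY]
    by (simp_all add: K2_def merge_def)
  have k: "card (conn_components ?E) = 2" "card (conn_components ?F) = 1"
    unfolding card_conn_components[OF labE] card_conn_components[OF labF]
    by (simp_all add: K2_def merge_def)
  have "weight ?E = 1" "weight ?F = 1"
    using card_components_free[OF wf(1)] card_components_free[OF wf(2)] linked k
    by (simp_all add: weight_def nullity_def K2_def)
  moreover have S: "{F \<in> Pow (edges K2). linked (K2\<lparr>edges := F\<rparr>) = b} = (if b then {{Initial}} else {{}})" for b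
    using linked by (auto simp: K2_def subset_singleton_iff)
  ultimately show "partial_sum K2 True = 1" "partial_sum K2 False = 1"
    unfolding partial_sum_def S by simp_all
qed

section \<open>Connectedness of the graphs and passage to the Tutte sums\<close>

lemma Gr_connected: "linked (Gr n) \<and> free_components (Gr n) = 0"
proof (induction n)
  case 0
  have "labels_components K2 (merge VX VY id)"
    using labels_components_insert[OF labels_components_no_edges, of K2 Initial VX VY]
    by (simp add: K2_def wf_mgraph_def)
  from same_component_label[OF this, of VX VY] card_conn_components[OF this]
  show ?case
    using card_components_free[OF wf_terminal_K2] by (simp add: K2_def merge_def)
next
  case (Suc n)
  \<comment> \<open>\<open>Gr (Suc n)\<close> is viewed as its own spanning subgraph. By induction
    all four copies are linked, so its skeleton is the full one, which is connected.\<close>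
  interpret glued "Gr n" "\<lambda>_. edges (Gr n)" True
    by unfold_locales (simp_all add: wf_terminal_Gr)
  have whole: "whole = Gr (Suc n)"
    by (auto simp: glue_edges_def step_def)
  have all: "(\<lambda>_::copy. True) = case_copy True True True True"
    by (auto split: copy.split)
  have lab: "labels_components (skeleton (\<lambda>_. True) True) (skeleton_label True True True True True)"
    unfolding all by (rule labels_components_skeleton)
  have "linked (skeleton (\<lambda>_. True) True)" "free_components (skeleton (\<lambda>_. True) True) = 0"
    using same_component_label[OF lab, of VX VY] card_conn_components[OF lab]
      card_components_free[OF wf_skeleton, of "\<lambda>_. True" True]
    by (simp_all add: skeleton_label_def merge_def specials_def)
  then show ?case
    using linked_whole free_components_whole Suc by (simp add: whole)
qed

text \<open>As \<open>Gr n\<close> is connected, the rank difference is the number of components of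
  \<open>H\<close> minus one: the free components, and one more if the special vertices are
  separated.\<close>

lemma tutte_term_Gr:
  assumes "F \<subseteq> edges (Gr n)"
  defines "H \<equiv> (Gr n)\<lparr>edges := F\<rparr>"
  shows "tutte_term (Gr n) H = (if linked H then weight H else (varx - 1) * weight H)"
proof -
  have wf: "wf_terminal H"
    using wf_terminal_Gr[of n] assms by (auto simp: wf_terminal_def intro: wf_subgraph)
  \<comment> \<open>This bound keeps the subtraction in \<open>rank H\<close> from
    truncating.\<close>
  then have "card (conn_components H) \<le> card (verts H)"
    by (intro card_conn_components_le) (simp add: wf_terminal_def wf_mgraph_def)
  moreover have "card (conn_components (Gr n)) = 1"
    using card_components_free[OF wf_terminal_Gr, of n] Gr_connected[of n] by simp
  moreover have "verts H = verts (Gr n)"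
    by (simp add: H_def)
  ultimately have "rank (Gr n) - rank H = free_components H + (if linked H then 0 else 1)"
    using card_components_free[OF wf] by (auto simp: rank_def)
  then show ?thesis
    by (simp add: tutte_term_def weight_def mult.assoc)
qed

lemma sum_spanning_subgraphs:
  "(\<Sum>H\<in>{H \<in> spanning_subgraphs G. P H}. h H) =
   (\<Sum>F\<in>{F \<in> Pow (edges G). P (G\<lparr>edges := F\<rparr>)}. h (G\<lparr>edges := F\<rparr>))"
proof -
  have "{H \<in> spanning_subgraphs G. P H} =
      (\<lambda>F. G\<lparr>edges := F\<rparr>) ` {F \<in> Pow (edges G). P (G\<lparr>edges := F\<rparr>)}"
    by (auto simp: spanning_subgraphs_eq)
  then show ?thesis
    by (simp add: sum.reindex inj_on_subset[OF inj_edges_update])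
qed

lemma T1_eq: "T1 n = partial_sum (Gr n) True"
  unfolding T1_def partial_sum_def sum_spanning_subgraphs
  by (intro sum.cong) (auto simp: tutte_term_Gr)

lemma T2_eq: "T2 n = (varx - 1) * partial_sum (Gr n) False"
  unfolding T2_def partial_sum_def sum_spanning_subgraphs sum_distrib_left
  by (intro sum.cong) (auto simp: tutte_term_Gr)

text \<open>The factor \<open>varx - 1\<close> is explicit in \<open>T2_eq\<close>, so it only has
  to be nonzero to cancel.\<close>

lemma N_eq: "N n = partial_sum (Gr n) False"
proof -
  have "varx - 1 \<noteq> 0"
    by (simp add: varx_def one_pCons)
  then show ?thesis
    by (simp add: N_def T2_eq)
qed

lemma tutte_Gr: "tutte (Gr n) = T1 n + (varx - 1) * N n"
proof -
  have "finite (spanning_subgraphs (Gr n))"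
    using wf_terminal_Gr[of n] by (simp add: spanning_subgraphs_eq wf_terminal_def wf_mgraph_def)
  then have "tutte (Gr n) = T1 n + T2 n"
    unfolding tutte_def T1_def T2_def
    by (subst sum.union_disjoint[symmetric]) (auto intro: sum.cong)
  then show ?thesis
    by (simp add: T2_eq N_eq)
qed

theorem theorem2:
  "(\<forall>n.
      tutte (Gr (Suc n)) = T1 (Suc n) + (varx - 1) * N (Suc n) \<and>
      T1 (Suc n) =
        vary * (vary - 1) * T1 n ^ 4 + 4 * vary * T1 n ^ 3 * N n
        + (2 * varx + 2) * T1 n ^ 2 * N n ^ 2 \<and>
      N (Suc n) =
        (2 * vary + 2) * T1 n ^ 2 * N n ^ 2 + 4 * varx * T1 n * N n ^ 3
        + varx * (varx - 1) * N n ^ 4) \<and>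
   T1 0 = 1 \<and> N 0 = 1"
  by (intro allI conjI tutte_Gr)
     (simp_all add: T1_eq N_eq partial_sum_recursion[OF wf_terminal_Gr] partial_sum_K2)

end
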